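(* For all integers $a,b$ with $2\le a\le b$, the reduced Euler characteristic of $\Delta(P(a,b))$ is $$\widetilde{\chi}(\Delta(P(a,b))) = (-1)^a\cdot 2\sum_{h=0}^{\lfloor a/2\rfloor-1}(-1)^h\binom{a-2}{h}\binom{b-a}{a-2-2h}.$$
   Context: Here $\mathbb{N}=\{0,1,2,\ldots\}$. For $(a_1,a_2),(b_1,b_2)\in\mathbb{N}^2$, say that $(a_1,a_2)$ properly divides $(b_1,b_2)$ if for each $i$ either $a_i=b_i=0$ or $a_i<b_i$. Write $(a_1,a_2)\le(b_1,b_2)$ if the two are equal or the first properly divides the second; this is a partial order. $P(a,b)$ is the set of all $(c,d)\in\mathbb{N}^2$ with $(c,d)\le(a,b)$, ordered by $\le$; it has unique minimal element $\widehat 0=(0,0)$ and unique maximal element $\widehat 1=(a,b)$. The order complex $\Delta(P(a,b))$ is the simplicial complex of all chains in $P(a,b)\setminus\{\widehat 0,\widehat 1\}$. Its reduced Euler characteristic is $\widetilde\chi(\Delta(P(a,b)))=\sum_{i\ge 0}(-1)^i\,\mathrm{rank}\,\widetilde H_i(\Delta(P(a,b));\mathbb{Z})$. Binomial coefficients are the usual ones, with $\binom{n}{k}=0$ for $k>n\ge 0$. *)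

theory Defs
  imports "HOL-Algebra.Free_Abelian_Groups" "HOL-Library.Groups_Big_Fun"
begin

subsection \<open>The rank of an abelian group\<close>

text \<open>Linear independence over the integers of the elements of \<open>S\<close>; the group operation is
  written multiplicatively, so an integer combination is a product of powers.\<close>

definition int_independent :: "('a, 'm) monoid_scheme \<Rightarrow> 'a set \<Rightarrow> bool" where
  "int_independent G S \<longleftrightarrow> finite S \<and> S \<subseteq> carrier G \<and>
     (\<forall>c :: 'a \<Rightarrow> int. finprod G (\<lambda>x. x [^]\<^bsub>G\<^esub> c x) S = \<one>\<^bsub>G\<^esub> \<longrightarrow> (\<forall>x\<in>S. c x = 0))"

text \<open>Meaningful for groups of finite rank only: the supremum of an unbounded set of
  natural numbers is unspecified.\<close>

definition abelian_rank :: "('a, 'm) monoid_scheme \<Rightarrow> nat" where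
  "abelian_rank G = Sup {card S | S. int_independent G S}"


subsection \<open>Reduced simplicial homology with integer coefficients\<close>

text \<open>A simplicial complex is a set \<open>K\<close> of finite sets closed under subsets; in particular the
  empty simplex, of dimension \<open>-1\<close>, belongs to every nonempty complex. The relation \<open>r\<close> is any
  relation that restricts to a linear order on each simplex; it fixes the orientations. Removing
  the \<open>j\<close>-th vertex (counted from \<open>0\<close>) of a simplex contributes the sign \<open>(-1)^j\<close>. On a vertex the
  boundary is the empty simplex, i.e. in degree \<open>0\<close> the boundary is the augmentation map, so the
  homology below is the reduced one.\<close>

definition simplex_boundary :: "('a \<Rightarrow> 'a \<Rightarrow> bool) \<Rightarrow> 'a set \<Rightarrow> 'a set \<Rightarrow>\<^sub>0 int" where
  "simplex_boundary r \<sigma> =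
     (\<Sum>v\<in>\<sigma>. frag_cmul ((-1) ^ card {w \<in> \<sigma>. r w v \<and> w \<noteq> v}) (frag_of (\<sigma> - {v})))"

definition simplicial_boundary :: "('a \<Rightarrow> 'a \<Rightarrow> bool) \<Rightarrow> ('a set \<Rightarrow>\<^sub>0 int) \<Rightarrow> 'a set \<Rightarrow>\<^sub>0 int" where
  "simplicial_boundary r = frag_extend (simplex_boundary r)"

text \<open>Simplices are counted by number of vertices: \<open>i\<close>-chains are generated by the simplices
  with \<open>i + 1\<close> vertices.\<close>

definition simplicial_chain_group :: "'a set set \<Rightarrow> nat \<Rightarrow> ('a set \<Rightarrow>\<^sub>0 int) monoid" where
  "simplicial_chain_group K i = free_Abelian_group {\<sigma> \<in> K. card \<sigma> = i + 1}"

definition simplicial_cycles ::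
    "('a \<Rightarrow> 'a \<Rightarrow> bool) \<Rightarrow> 'a set set \<Rightarrow> nat \<Rightarrow> ('a set \<Rightarrow>\<^sub>0 int) set" where
  "simplicial_cycles r K i =
     {c \<in> carrier (simplicial_chain_group K i). simplicial_boundary r c = 0}"

definition simplicial_boundaries ::
    "('a \<Rightarrow> 'a \<Rightarrow> bool) \<Rightarrow> 'a set set \<Rightarrow> nat \<Rightarrow> ('a set \<Rightarrow>\<^sub>0 int) set" where
  "simplicial_boundaries r K i =
     simplicial_boundary r ` carrier (simplicial_chain_group K (i + 1))"

definition reduced_simplicial_homology ::
    "('a \<Rightarrow> 'a \<Rightarrow> bool) \<Rightarrow> 'a set set \<Rightarrow> nat \<Rightarrow> ('a set \<Rightarrow>\<^sub>0 int) set monoid" where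
  "reduced_simplicial_homology r K i =
     subgroup_generated (simplicial_chain_group K i) (simplicial_cycles r K i)
       Mod simplicial_boundaries r K i"

text \<open>\<open>Sum_any\<close> is the sum over all \<open>i \<ge> 0\<close> of a finitely supported function.\<close>

definition reduced_euler_characteristic ::
    "('a \<Rightarrow> 'a \<Rightarrow> bool) \<Rightarrow> 'a set set \<Rightarrow> int" where
  "reduced_euler_characteristic r K =
     Sum_any (\<lambda>i::nat. (-1) ^ i * int (abelian_rank (reduced_simplicial_homology r K i)))"


subsection \<open>Order complexes\<close>

definition order_complex :: "('a \<Rightarrow> 'a \<Rightarrow> bool) \<Rightarrow> 'a set \<Rightarrow> 'a set set" where
  "order_complex r X = {\<sigma>. finite \<sigma> \<and> \<sigma> \<subseteq> X \<and> Complete_Partial_Order.chain r \<sigma>}"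


subsection \<open>The posets of proper divisors\<close>

definition properly_divides :: "nat \<times> nat \<Rightarrow> nat \<times> nat \<Rightarrow> bool" where
  "properly_divides p q \<longleftrightarrow>
     (fst p = 0 \<and> fst q = 0 \<or> fst p < fst q) \<and> (snd p = 0 \<and> snd q = 0 \<or> snd p < snd q)"

definition pd_le :: "nat \<times> nat \<Rightarrow> nat \<times> nat \<Rightarrow> bool" where
  "pd_le p q \<longleftrightarrow> p = q \<or> properly_divides p q"

definition pd_poset :: "nat \<Rightarrow> nat \<Rightarrow> (nat \<times> nat) set" where
  "pd_poset a b = {p. pd_le p (a, b)}"

definition pd_order_complex :: "nat \<Rightarrow> nat \<Rightarrow> (nat \<times> nat) set set" where
  "pd_order_complex a b = order_complex pd_le (pd_poset a b - {(0, 0), (a, b)})"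

lemma pd_le_partial_order: "class.order pd_le (\<lambda>p q. pd_le p q \<and> \<not> pd_le q p)"
  by standard (auto simp: pd_le_def properly_divides_def prod_eq_iff)

lemma pd_poset_bounds: "(0, 0) \<in> pd_poset a b" "(a, b) \<in> pd_poset a b" "p \<in> pd_poset a b \<Longrightarrow> pd_le (0, 0) p \<and> pd_le p (a, b)"
  by (auto simp: pd_poset_def pd_le_def properly_divides_def prod_eq_iff)


subsection \<open>The boundary of a boundary vanishes\<close>

lemma simplex_boundary_boundary:
  assumes fin: "finite \<sigma>" and tot: "Complete_Partial_Order.chain r \<sigma>"
    and anti: "\<And>x y. x \<in> \<sigma> \<Longrightarrow> y \<in> \<sigma> \<Longrightarrow> r x y \<Longrightarrow> r y x \<Longrightarrow> x = y"
  shows "simplicial_boundary r (simplex_boundary r \<sigma>) = 0"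
proof -
  define n where "n \<tau> v = card {w \<in> \<tau>. r w v \<and> w \<noteq> v}" for \<tau> v
  define f where "f v w = frag_cmul ((-1) ^ (n \<sigma> v + n (\<sigma> - {v}) w)) (frag_of (\<sigma> - {v} - {w}))" for v w
  define S where "S = {(v, w). v \<in> \<sigma> \<and> w \<in> \<sigma> - {v}}"
  have neg: "f v w = - f w v" if "r v w" "v \<in> \<sigma>" "w \<in> \<sigma>" "v \<noteq> w" for v w
  proof -
    have "{u \<in> \<sigma>. r u w \<and> u \<noteq> w} = insert v {u \<in> \<sigma> - {v}. r u w \<and> u \<noteq> w}"
      using that by auto
    hence "n \<sigma> w = Suc (n (\<sigma> - {v}) w)" using fin by (simp add: n_def)
    moreover have "{u \<in> \<sigma> - {w}. r u v \<and> u \<noteq> v} = {u \<in> \<sigma>. r u v \<and> u \<noteq> v}"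
      using that anti by auto
    hence "n (\<sigma> - {w}) v = n \<sigma> v" by (simp add: n_def)
    ultimately show ?thesis
      by (simp add: f_def Diff_insert2[symmetric] insert_commute add.commute)
  qed
  have neg': "f v w = - f w v" if "(v, w) \<in> S" for v w
    using tot that neg[of v w] neg[of w v]
    unfolding S_def Complete_Partial_Order.chain_def by force
  have "simplicial_boundary r (simplex_boundary r \<sigma>) = (\<Sum>v\<in>\<sigma>. \<Sum>w\<in>\<sigma> - {v}. f v w)"
    using fin by (simp add: simplicial_boundary_def simplex_boundary_def frag_extend_sum
        frag_extend_cmul frag_cmul_sum f_def n_def power_add o_def)
  also have "\<dots> = (\<Sum>(v, w)\<in>S. f v w)"
    using fin by (subst sum.Sigma) (auto simp: S_def Sigma_def intro!: sum.cong)
  finally have eq: "simplicial_boundary r (simplex_boundary r \<sigma>) = (\<Sum>(v, w)\<in>S. f v w)" .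
  have "(\<Sum>(v, w)\<in>S. f v w) = (\<Sum>(v, w)\<in>S. - f w v)"
    using neg' by (intro sum.cong) auto
  also have "\<dots> = - (\<Sum>(v, w)\<in>S. f w v)"
    by (simp add: case_prod_unfold sum_negf)
  also have "(\<Sum>(v, w)\<in>S. f w v) = (\<Sum>(v, w)\<in>S. f v w)"
    by (rule sum.reindex_bij_witness[of _ prod.swap prod.swap]) (auto simp: S_def)
  finally have "(\<Sum>(v, w)\<in>S. f v w) = - (\<Sum>(v, w)\<in>S. f v w)" .
  hence "(\<Sum>(v, w)\<in>S. f v w) = 0"
    by (metis equal_neg_zero lookup_uminus lookup_zero poly_mapping_eqI)
  with eq show ?thesis by simp
qed

end

theory Submission
  imports Complex_Main "HOL-Library.Function_Algebras"
    "HOL-Computational_Algebra.Polynomial" Defs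
begin

text \<open>
  The reduced Euler characteristic of the order complex is the Moebius number
  \<open>\<mu>(a, b)\<close> of the interval from \<open>(0, 0)\<close> to \<open>(a, b)\<close>, and this number satisfies a linear
  recurrence that is solved by coefficients of \<open>(1 - x)\<^sup>n (1 + x)\<^sup>m\<close>.

  From homology to counting. Replacing ranks of homology groups by numbers of simplices is the
  Euler-Poincare argument. It rests on two additivity properties of ranks,
  \<open>rank (C / B) = rank C - rank B\<close> (\<open>abelian_rank_quotient\<close>) and rank-nullity
  (\<open>rank_nullity\<close>). Both reduce to linear algebra over the rationals: the rank of a group \<open>A\<close>
  of integer chains is the dimension of its rational span, and the largest number of elements of
  \<open>A\<close> that are integrally independent modulo a subgroup \<open>B\<close> is the difference of the two
  dimensions. With the augmented chain complex the alternating sum telescopes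
  (\<open>reduced_euler_characteristic_alternating_sum\<close>).

  From counting to a recurrence. Splitting off the greatest element of a nonempty chain
  (\<open>order_complex_alternating_sum\<close>) gives the defining property of the Moebius function: the
  sum of \<open>\<mu>(c, d)\<close> over all \<open>(c, d) \<le> (a, b)\<close> is zero unless \<open>(a, b) = (0, 0)\<close>. Below \<open>(a, b)\<close> with
  \<open>a, b \<ge> 1\<close> the strictly smaller elements form the full rectangle of pairs \<open>(c, d)\<close> with
  \<open>c < a\<close>, \<open>d < b\<close>. A sum over rectangles is undone by a mixed second difference, whence
  \<open>\<mu>(a+1, b+1) = \<mu>(a+1, b) + \<mu>(a, b+1) - 2 \<mu>(a, b)\<close> for \<open>a, b \<ge> 1\<close>.

  Solving the recurrence. In generating functions, \<open>\<mu>(m+2, n+2)\<close> is twice the coefficient of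
  \<open>x\<^sup>m y\<^sup>n\<close> in \<open>1 / (1 - x - y + 2xy)\<close>. The coefficient of \<open>x\<^sup>m\<close> in \<open>(1 - x)\<^sup>n (1 + x)\<^sup>m\<close> obeys
  the same recurrence with the same boundary values, so the two agree
  (\<open>pd_mobius_eq_krawtchouk\<close>). For \<open>m \<le> n\<close> that polynomial is
  \<open>(1 - x\<^sup>2)\<^sup>m (1 - x)\<^bsup>n - m\<^esup>\<close>, and expanding both factors gives the stated sum.
\<close>

section \<open>Ranks of groups of integer chains\<close>

interpretation Z: Modules.module "frag_cmul :: int \<Rightarrow> ('s \<Rightarrow>\<^sub>0 int) \<Rightarrow> 's \<Rightarrow>\<^sub>0 int"
  by standard (auto simp: frag_cmul_distrib frag_cmul_distrib2)

interpretation Q: vector_space "\<lambda>(q::rat) (f :: 's \<Rightarrow> rat) s. q * f s"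
  by standard (auto simp: fun_eq_iff algebra_simps)

definition rat_vec :: "('s \<Rightarrow>\<^sub>0 int) \<Rightarrow> 's \<Rightarrow> rat" where
  "rat_vec c s = rat_of_int (Poly_Mapping.lookup c s)"

lemma rat_vec_inj: "inj rat_vec"
  by (auto simp: inj_def rat_vec_def fun_eq_iff poly_mapping_eq_iff)

lemma rat_vec_0 [simp]: "rat_vec 0 = 0"
  by (simp add: rat_vec_def fun_eq_iff)

lemma rat_vec_eq_0_iff [simp]: "rat_vec c = 0 \<longleftrightarrow> c = 0"
  using rat_vec_inj by (metis inj_eq rat_vec_0)

lemma rat_vec_add: "rat_vec (c + d) = rat_vec c + rat_vec d"
  by (simp add: rat_vec_def fun_eq_iff lookup_add)

lemma rat_vec_cmul: "rat_vec (frag_cmul n c) = (\<lambda>s. rat_of_int n * rat_vec c s)"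
  by (simp add: rat_vec_def fun_eq_iff)

lemma rat_vec_sum: "rat_vec (\<Sum>x\<in>S. f x) = (\<Sum>x\<in>S. rat_vec (f x))"
  by (induction S rule: infinite_finite_induct) (auto simp: rat_vec_add)

text \<open>For \<open>B\<close> a subgroup this says that the classes of the elements of \<open>S\<close> modulo \<open>B\<close> are
  pairwise distinct and integrally independent. Keeping representatives instead of cosets lets
  quotient groups and images under homomorphisms be treated alike.\<close>

definition independent_modulo :: "('s \<Rightarrow>\<^sub>0 int) set \<Rightarrow> ('s \<Rightarrow>\<^sub>0 int) set \<Rightarrow> bool" where
  "independent_modulo B S \<longleftrightarrow> finite S \<and>
     (\<forall>c. (\<Sum>x\<in>S. frag_cmul (c x) x) \<in> B \<longrightarrow> (\<forall>x\<in>S. c x = 0))"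

lemma independent_moduloD:
  "independent_modulo B S \<Longrightarrow> (\<Sum>x\<in>S. frag_cmul (c x) x) \<in> B \<Longrightarrow> x \<in> S \<Longrightarrow> c x = 0"
  by (auto simp: independent_modulo_def)

text \<open>If \<open>x \<noteq> y\<close> then \<open>x - y\<close> is itself a nontrivial combination that lies in \<open>B\<close>. Thus
  the quotient map by \<open>B\<close>, and any homomorphism with kernel \<open>B\<close>, is injective on \<open>S\<close>.\<close>

lemma independent_modulo_eq:
  assumes S: "independent_modulo B S" "x \<in> S" "y \<in> S" and "x - y \<in> B"
  shows "x = y"
proof (rule ccontr)
  assume "x \<noteq> y"
  let ?c = "\<lambda>z. (if z = x then 1 else 0) - (if z = y then 1 else 0) :: int"
  have "finite S" using S(1) by (simp add: independent_modulo_def)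
  have "(\<Sum>z\<in>S. frag_cmul (?c z) z) = (\<Sum>z\<in>S. (if z = x then z else 0) - (if z = y then z else 0))"
    by (rule sum.cong) auto
  also have "\<dots> = x - y" using S(2,3) \<open>finite S\<close> by (simp add: sum_subtractf)
  finally show False using independent_moduloD[OF S(1), of ?c x] assms(4) S(2) \<open>x \<noteq> y\<close> by simp
qed

lemma common_denominator:
  fixes q :: "'a \<Rightarrow> rat"
  assumes "finite T"
  shows "\<exists>N::int. N \<noteq> 0 \<and> (\<forall>x\<in>T. \<exists>n::int. of_int N * q x = of_int n)"
  using assms
proof (induction T)
  case (insert y T)
  then obtain N :: int where N: "N \<noteq> 0" "\<forall>x\<in>T. \<exists>n::int. of_int N * q x = of_int n" by auto
  obtain a b where ab: "q y = of_int a / of_int b" "b > 0"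
    by (metis quotient_of_div quotient_of_denom_pos surj_pair)
  have "\<exists>n::int. of_int (N * b) * q x = of_int n" if x: "x \<in> T" for x
  proof -
    obtain n :: int where n: "of_int N * q x = of_int n"
      using bspec[OF N(2) x] ..
    have "of_int (N * b) * q x = of_int b * (of_int N * q x)" by simp
    also have "\<dots> = of_int (b * n)" by (simp only: n of_int_mult)
    finally show ?thesis by blast
  qed
  moreover have "of_int (N * b) * q y = of_int (N * a)" using ab by simp
  ultimately have "\<forall>x\<in>insert y T. \<exists>n::int. of_int (N * b) * q x = of_int n" by blast
  moreover have "N * b \<noteq> 0" using N(1) ab(2) by simp
  ultimately show ?case by blast
qed (auto intro: exI[of _ 1])

lemma rat_vec_combination:
  "rat_vec (\<Sum>x\<in>S. frag_cmul (c x) x) = (\<Sum>x\<in>S. (\<lambda>s. rat_of_int (c x) * rat_vec x s))"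
  by (simp add: rat_vec_sum rat_vec_cmul)

lemma rat_vec_sum_image:
  "(\<Sum>v\<in>rat_vec ` S. (\<lambda>s. u v * v s)) = (\<Sum>x\<in>S. (\<lambda>s. u (rat_vec x) * rat_vec x s))"
  by (rule sum.reindex_cong[of rat_vec]) (auto intro: inj_on_subset[OF rat_vec_inj])

text \<open>A rational relation becomes an integral one after multiplication by a common
  denominator.\<close>

lemma independent_rat_vec_iff:
  assumes "finite T"
  shows "Q.independent (rat_vec ` T) \<longleftrightarrow> independent_modulo {0} T"
proof
  assume ind: "Q.independent (rat_vec ` T)"
  have "c x = 0" if "(\<Sum>x\<in>T. frag_cmul (c x) x) = 0" "x \<in> T" for c x
  proof -
    let ?u = "\<lambda>v. rat_of_int (c (inv_into UNIV rat_vec v))"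
    have "(\<Sum>v\<in>rat_vec ` T. (\<lambda>s. ?u v * v s)) = rat_vec (\<Sum>x\<in>T. frag_cmul (c x) x)"
      by (simp only: rat_vec_combination rat_vec_sum_image inv_f_f[OF rat_vec_inj])
    then have "(\<Sum>v\<in>rat_vec ` T. (\<lambda>s. ?u v * v s)) = 0" using that by simp
    from Q.independentD[OF ind _ subset_refl this, of "rat_vec x"] assms that
    show ?thesis by (simp add: inv_f_f[OF rat_vec_inj])
  qed
  then show "independent_modulo {0} T" using assms by (auto simp: independent_modulo_def)
next
  assume ind: "independent_modulo {0} T"
  show "Q.independent (rat_vec ` T)"
  proof (rule Q.independent_if_scalars_zero)
    fix u v assume 0: "(\<Sum>v\<in>rat_vec ` T. (\<lambda>s. u v * v s)) = 0" and "v \<in> rat_vec ` T"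
    then obtain y where y: "y \<in> T" "v = rat_vec y" by auto
    obtain N :: int where N: "N \<noteq> 0" "\<forall>x\<in>T. \<exists>n::int. of_int N * u (rat_vec x) = of_int n"
      using common_denominator[OF assms, of "\<lambda>x. u (rat_vec x)"] by auto
    then obtain n :: "_ \<Rightarrow> int" where n: "\<And>x. x \<in> T \<Longrightarrow> of_int N * u (rat_vec x) = of_int (n x)"
      by metis
    have "rat_vec (\<Sum>x\<in>T. frag_cmul (n x) x)
        = (\<Sum>x\<in>T. (\<lambda>s. rat_of_int N * (u (rat_vec x) * rat_vec x s)))"
      unfolding rat_vec_combination
      by (rule sum.cong) (simp_all only: n[symmetric] mult.assoc)
    also have "\<dots> = (\<lambda>s. rat_of_int N * (\<Sum>x\<in>T. (\<lambda>s. u (rat_vec x) * rat_vec x s)) s)"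
      by (rule Q.scale_sum_right[symmetric])
    also have "\<dots> = 0" by (simp only: 0[unfolded rat_vec_sum_image]) (simp add: fun_eq_iff)
    finally have "(\<Sum>x\<in>T. frag_cmul (n x) x) = 0" by (simp only: rat_vec_eq_0_iff)
    with ind have "n y = 0" using y by (auto simp: independent_modulo_def)
    with n[OF y(1)] N y show "u v = 0" by simp
  qed (use assms in auto)
qed

definition lattice_rank :: "('s \<Rightarrow>\<^sub>0 int) set \<Rightarrow> nat" where
  "lattice_rank A = Q.dim (rat_vec ` A)"

lemma rat_vec_span: "rat_vec ` Z.span F \<subseteq> Q.span (rat_vec ` F)"
proof safe
  fix x assume "x \<in> Z.span F"
  then show "rat_vec x \<in> Q.span (rat_vec ` F)"
  proof (induction rule: Z.span_induct_alt)
    case base show ?case by (simp only: rat_vec_0 Q.span_zero)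
  next
    case (step c x y)
    then show ?case
      unfolding rat_vec_add rat_vec_cmul
      by (intro Q.span_add Q.span_scale) (auto intro: Q.span_base)
  qed
qed

text \<open>An infinite basis has cardinality \<open>0\<close> by convention, so the comparison results
  for \<open>lattice_rank\<close> need this hypothesis; it holds for all chain groups of a finite complex.\<close>

definition finite_rank :: "('s \<Rightarrow>\<^sub>0 int) set \<Rightarrow> bool" where
  "finite_rank A \<longleftrightarrow> (\<exists>F. finite F \<and> A \<subseteq> Z.span F)"

lemma finite_rank_independent_finite:
  assumes "finite_rank A" "Q.independent B" "B \<subseteq> rat_vec ` A"
  shows "finite B"
proof -
  obtain F where F: "finite F" "A \<subseteq> Z.span F" using assms(1) by (auto simp: finite_rank_def)
  have "B \<subseteq> Q.span (rat_vec ` F)" using assms(3) F(2) rat_vec_span[of F] by blast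
  with Q.independent_span_bound[of "rat_vec ` F" B] assms(2) F(1) show ?thesis by auto
qed

lemma independent_card_le_lattice_rank:
  assumes A: "finite_rank A" and S: "S \<subseteq> A" "independent_modulo {0} S"
  shows "card S \<le> lattice_rank A"
proof -
  have "finite S" using S(2) by (simp add: independent_modulo_def)
  then have "Q.independent (rat_vec ` S)" using S(2) independent_rat_vec_iff by blast
  then obtain B where B: "rat_vec ` S \<subseteq> B" "B \<subseteq> rat_vec ` A" "Q.independent B" "rat_vec ` A \<subseteq> Q.span B"
    using Q.maximal_independent_subset_extend[of "rat_vec ` S" "rat_vec ` A"] S(1) by blast
  have "card S = card (rat_vec ` S)"
    by (simp add: card_image inj_on_subset[OF rat_vec_inj])
  also have "\<dots> \<le> card B" using finite_rank_independent_finite[OF A B(3,2)] B(1) by (rule card_mono)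
  also have "card B = lattice_rank A"
    unfolding lattice_rank_def using B by (intro Q.basis_card_eq_dim) auto
  finally show ?thesis .
qed

text \<open>A basis of the rational span of \<open>B\<close> taken inside \<open>B\<close> stays independent when \<open>S\<close> is
  added: in a relation between the two, the part supported on \<open>S\<close> lies in \<open>B\<close> and hence
  vanishes.\<close>

lemma independent_modulo_card_le:
  assumes A: "finite_rank A" and B: "Z.subspace B" "B \<subseteq> A"
    and S: "S \<subseteq> A" "independent_modulo B S"
  shows "card S + lattice_rank B \<le> lattice_rank A"
proof -
  have finS: "finite S" using S by (simp add: independent_modulo_def)
  have indS: "\<And>c x. (\<Sum>x\<in>S. frag_cmul (c x) x) \<in> B \<Longrightarrow> x \<in> S \<Longrightarrow> c x = 0"
    using S(2) by (auto simp: independent_modulo_def)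
  obtain B' where B': "B' \<subseteq> rat_vec ` B" "Q.independent B'" "card B' = lattice_rank B"
    unfolding lattice_rank_def by (metis Q.basis_exists)
  have "finite B'" using finite_rank_independent_finite[OF A B'(2)] B'(1) B(2) by blast
  then obtain T where T: "T \<subseteq> B" "finite T" "B' = rat_vec ` T"
    using finite_subset_image[OF _ B'(1)] by metis
  have cardT: "card T = lattice_rank B"
    using B'(3) T(3) by (simp add: card_image inj_on_subset[OF rat_vec_inj])
  have indT: "\<And>c x. (\<Sum>x\<in>T. frag_cmul (c x) x) = 0 \<Longrightarrow> x \<in> T \<Longrightarrow> c x = 0"
    using independent_rat_vec_iff[OF T(2)] B'(2) T(3) by (auto simp: independent_modulo_def)
  have disj: "S \<inter> T = {}"
  proof (rule ccontr)
    assume "S \<inter> T \<noteq> {}"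
    then obtain y where y: "y \<in> S" "y \<in> T" by auto
    have "(\<Sum>x\<in>S. frag_cmul (if x = y then 1 else 0) x) = (\<Sum>x\<in>S. if x = y then x else 0)"
      by (rule sum.cong) auto
    also have "\<dots> = y" using y finS by simp
    also have "y \<in> B" using y T by blast
    finally show False using indS[of "\<lambda>x. if x = y then 1 else 0" y] y by simp
  qed
  have "independent_modulo {0} (S \<union> T)"
    unfolding independent_modulo_def
  proof (intro conjI allI impI ballI)
    fix c x assume "(\<Sum>x\<in>S \<union> T. frag_cmul (c x) x) \<in> {0}" and x: "x \<in> S \<union> T"
    then have sum: "(\<Sum>x\<in>S. frag_cmul (c x) x) + (\<Sum>x\<in>T. frag_cmul (c x) x) = 0"
      using finS T(2) disj by (simp add: sum.union_disjoint)
    then have "(\<Sum>x\<in>S. frag_cmul (c x) x) = - (\<Sum>x\<in>T. frag_cmul (c x) x)"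
      by (simp add: eq_neg_iff_add_eq_0)
    also have "\<dots> \<in> B"
      using T(1) by (intro Z.subspace_neg[OF B(1)] Z.subspace_sum[OF B(1)] Z.subspace_scale[OF B(1)]) auto
    finally have 0: "c x = 0" if "x \<in> S" for x using indS that by blast
    with sum have "(\<Sum>x\<in>T. frag_cmul (c x) x) = 0" by simp
    with 0 indT x show "c x = 0" by blast
  qed (use finS T in auto)
  from independent_card_le_lattice_rank[OF A _ this] S(1) T(1) B(2)
  show ?thesis using finS T(2) disj cardT by (simp add: card_Un_disjoint)
qed

text \<open>Extend a basis of the rational span of \<open>B\<close> to one of the span of \<open>A\<close>, with all
  vectors chosen inside \<open>A\<close>. The added vectors are independent even modulo the rational
  span of \<open>B\<close>.\<close>

lemma independent_modulo_attained:
  assumes A: "finite_rank A" and B: "B \<subseteq> A"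
  obtains S where "S \<subseteq> A" "independent_modulo B S" "card S + lattice_rank B = lattice_rank A"
proof -
  obtain B' where B': "B' \<subseteq> rat_vec ` B" "Q.independent B'" "rat_vec ` B \<subseteq> Q.span B'" "card B' = lattice_rank B"
    unfolding lattice_rank_def by (metis Q.basis_exists)
  obtain A' where A': "B' \<subseteq> A'" "A' \<subseteq> rat_vec ` A" "Q.independent A'" "rat_vec ` A \<subseteq> Q.span A'"
    by (rule Q.maximal_independent_subset_extend[OF order_trans[OF B'(1) image_mono[OF B]] B'(2)])
  have finA: "finite A'" using finite_rank_independent_finite[OF A A'(3,2)] .
  have cardA: "card A' = lattice_rank A"
    unfolding lattice_rank_def using A' by (intro Q.basis_card_eq_dim) auto
  have "finite (A' - B')" "A' - B' \<subseteq> rat_vec ` A" using finA A' by auto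
  then obtain S where S: "S \<subseteq> A" "finite S" "A' - B' = rat_vec ` S"
    using finite_subset_image by metis
  have finB: "finite B'" using finA A'(1) finite_subset by blast
  have "independent_modulo B S"
    unfolding independent_modulo_def
  proof (intro conjI allI impI ballI)
    fix c x assume inB: "(\<Sum>x\<in>S. frag_cmul (c x) x) \<in> B" and x: "x \<in> S"
    let ?c = "\<lambda>v. rat_of_int (c (inv_into UNIV rat_vec v))"
    have "rat_vec (\<Sum>x\<in>S. frag_cmul (c x) x) \<in> Q.span B'" using inB B'(3) by blast
    then obtain u where u: "rat_vec (\<Sum>x\<in>S. frag_cmul (c x) x) = (\<Sum>v\<in>B'. (\<lambda>s. u v * v s))"
      unfolding Q.span_finite[OF finB] by auto
    have "rat_vec (\<Sum>x\<in>S. frag_cmul (c x) x) = (\<Sum>v\<in>A' - B'. (\<lambda>s. ?c v * v s))"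
      by (simp only: S(3) rat_vec_combination rat_vec_sum_image inv_f_f[OF rat_vec_inj])
    with u have eq: "(\<Sum>v\<in>A' - B'. (\<lambda>s. ?c v * v s)) = (\<Sum>v\<in>B'. (\<lambda>s. u v * v s))" by simp
    \<comment> \<open>The two expansions of the same vector combine into one relation on the basis \<open>A'\<close>.\<close>
    define w where "w v = (if v \<in> B' then - u v else ?c v)" for v
    have "(\<Sum>v\<in>A'. (\<lambda>s. w v * v s)) = (\<Sum>v\<in>A' - B'. (\<lambda>s. w v * v s)) + (\<Sum>v\<in>B'. (\<lambda>s. w v * v s))"
      by (rule sum.subset_diff[OF A'(1) finA])
    also have "(\<Sum>v\<in>A' - B'. (\<lambda>s. w v * v s)) = (\<Sum>v\<in>A' - B'. (\<lambda>s. ?c v * v s))"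
      by (rule sum.cong) (auto simp: w_def)
    also have "(\<Sum>v\<in>B'. (\<lambda>s. w v * v s)) = (\<Sum>v\<in>B'. - (\<lambda>s. u v * v s))"
      by (rule sum.cong) (auto simp: w_def)
    also have "\<dots> = - (\<Sum>v\<in>B'. (\<lambda>s. u v * v s))" by (rule sum_negf)
    finally have "(\<Sum>v\<in>A'. (\<lambda>s. w v * v s)) = 0" using eq by (simp only: add.right_inverse)
    from Q.independentD[OF A'(3) finA subset_refl this, of "rat_vec x"] S(3) x
    have "w (rat_vec x) = 0" by auto
    moreover have "rat_vec x \<notin> B'" using S(3) x by auto
    ultimately show "c x = 0" by (simp add: w_def inv_f_f[OF rat_vec_inj])
  qed (fact S)
  moreover have "card S = card (A' - B')"
    unfolding S(3) by (simp add: card_image inj_on_subset[OF rat_vec_inj])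
  then have "card S + lattice_rank B = lattice_rank A"
    using card_Diff_subset[OF finB A'(1)] card_mono[OF finA A'(1)] B'(4) cardA by simp
  ultimately show ?thesis using that S(1) by blast
qed

lemma lattice_rank_0 [simp]: "lattice_rank {0} = 0"
proof -
  have "Q.span {0 :: 'a \<Rightarrow> rat} = Q.span {}" by (rule Q.span_insert_0)
  then have "Q.dim {0 :: 'a \<Rightarrow> rat} = card ({} :: ('a \<Rightarrow> rat) set)"
    by (metis Q.dim_span Q.dim_eq_card_independent Q.independent_empty)
  then show ?thesis by (simp only: lattice_rank_def image_insert image_empty rat_vec_0 card.empty)
qed

text \<open>A homomorphism turns independence modulo its kernel into plain independence of the
  images. Transporting maximal independent sets in both directions gives the two inequalities,
  without extending \<open>f\<close> to rational vectors.\<close>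

lemma rank_nullity:
  assumes A: "finite_rank A" "Z.subspace A" and f: "Modules.additive f"
    and cmul: "\<And>n x. f (frag_cmul n x) = frag_cmul n (f x)"
  shows "lattice_rank A = lattice_rank {x \<in> A. f x = 0} + lattice_rank (f ` A)"
proof -
  interpret f: module_hom frag_cmul frag_cmul f
    using f cmul by unfold_locales (auto simp: additive_def)
  let ?K = "{x \<in> A. f x = 0}"
  have comb: "f (\<Sum>x\<in>S. frag_cmul (c x) x) = (\<Sum>x\<in>S. frag_cmul (c x) (f x))" for S c
    by (simp add: f.sum f.scale)
  have subA: "(\<Sum>x\<in>S. frag_cmul (c x) x) \<in> A" if "S \<subseteq> A" for S c
    using that by (intro Z.subspace_sum[OF A(2)] Z.subspace_scale[OF A(2)]) auto
  have K: "Z.subspace ?K" using A(2) by (auto simp: Z.subspace_def f.add f.scale)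
  have fA: "Z.subspace (f ` A)" using f.subspace_image A(2) .
  have "finite_rank (f ` A)"
  proof -
    obtain F where "finite F" "A \<subseteq> Z.span F" using A(1) by (auto simp: finite_rank_def)
    then have "finite (f ` F)" "f ` A \<subseteq> Z.span (f ` F)" using f.span_image by auto
    then show ?thesis unfolding finite_rank_def by blast
  qed
  note bound = independent_card_le_lattice_rank[OF this]
  obtain S where S: "S \<subseteq> A" "independent_modulo ?K S" "card S + lattice_rank ?K = lattice_rank A"
    using independent_modulo_attained[OF A(1), of ?K] by auto
  have finS: "finite S" and indS: "\<And>c x. (\<Sum>x\<in>S. frag_cmul (c x) x) \<in> ?K \<Longrightarrow> x \<in> S \<Longrightarrow> c x = 0"
    using S(2) by (auto simp: independent_modulo_def)
  have injS: "inj_on f S"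
  proof (rule inj_onI)
    fix x y assume xy: "x \<in> S" "y \<in> S" "f x = f y"
    then have "x - y \<in> ?K" using S(1) Z.subspace_diff[OF A(2)] by (auto simp: f.diff)
    then show "x = y" using independent_modulo_eq[OF S(2)] xy by blast
  qed
  have "independent_modulo {0} (f ` S)"
    unfolding independent_modulo_def
  proof (intro conjI allI impI ballI)
    fix c y assume "(\<Sum>x\<in>f ` S. frag_cmul (c x) x) \<in> {0}" and y: "y \<in> f ` S"
    then have "f (\<Sum>x\<in>S. frag_cmul (c (f x)) x) = 0"
      by (simp add: comb sum.reindex[OF injS])
    with subA[OF S(1)] have "(\<Sum>x\<in>S. frag_cmul (c (f x)) x) \<in> ?K" by simp
    from indS[OF this] y show "c y = 0" by auto
  qed (use finS in auto)
  then have 1: "card S \<le> lattice_rank (f ` A)"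
    using bound[of "f ` S"] S(1) by (auto simp: card_image[OF injS])
  obtain T where T: "T \<subseteq> f ` A" "independent_modulo {0} T" "card T + lattice_rank {0 :: 'b \<Rightarrow>\<^sub>0 int} = lattice_rank (f ` A)"
    using independent_modulo_attained[OF \<open>finite_rank (f ` A)\<close>, of "{0}"] Z.subspace_0[OF fA] by auto
  obtain U where U: "U \<subseteq> A" "inj_on f U" "T = f ` U"
    using T(1) subset_image_inj[of T f A] by auto
  have finU: "finite U" using T(2) U(2,3) by (auto simp: independent_modulo_def finite_image_iff)
  have "independent_modulo ?K U"
    unfolding independent_modulo_def
  proof (intro conjI allI impI ballI)
    fix c x assume "(\<Sum>x\<in>U. frag_cmul (c x) x) \<in> ?K" and x: "x \<in> U"
    then have 0: "(\<Sum>y\<in>T. frag_cmul (c (the_inv_into U f y)) y) = 0"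
      by (simp add: comb U(3) sum.reindex[OF U(2)] the_inv_into_f_f[OF U(2)])
    have "\<forall>y\<in>T. d y = 0" if "(\<Sum>y\<in>T. frag_cmul (d y) y) = 0" for d
      using T(2) that unfolding independent_modulo_def by simp
    from this[OF 0] have "c (the_inv_into U f (f x)) = 0" using x U(3) by simp
    then show "c x = 0" using x by (simp add: the_inv_into_f_f[OF U(2)])
  qed (fact finU)
  from independent_modulo_card_le[OF A(1) K _ U(1) this]
  have "card T + lattice_rank ?K \<le> lattice_rank A" by (simp add: U(3) card_image[OF U(2)])
  with 1 S(3) T(3) show ?thesis by simp
qed

text \<open>Finite sets of cosets correspond to finite sets of representatives on which the quotient
  map is injective, and under this correspondence integral independence in the quotient is
  independence modulo \<open>B\<close>. So the supremum in the definition of the rank is the maximum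
  determined by \<open>independent_modulo_card_le\<close> and \<open>independent_modulo_attained\<close>.\<close>

lemma abelian_rank_quotient:
  assumes C: "Z.subspace C" "finite_rank C" and X: "\<And>x. x \<in> C \<Longrightarrow> Poly_Mapping.keys x \<subseteq> X"
    and B: "Z.subspace B" "B \<subseteq> C"
  shows "abelian_rank (subgroup_generated (free_Abelian_group X) C Mod B) = lattice_rank C - lattice_rank B"
proof -
  define G where "G = free_Abelian_group X"
  define H where "H = subgroup_generated G C"
  define F where "F = H Mod B"
  define h where "h x = B #>\<^bsub>H\<^esub> x" for x
  interpret G: comm_group G unfolding G_def by (rule abelian_free_Abelian_group)
  have sub: "subgroup D G" if "Z.subspace D" "D \<subseteq> C" for D
  proof
    show "D \<subseteq> carrier G" using that X by (auto simp: G_def)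
    fix x assume "x \<in> D"
    then have "Poly_Mapping.keys x \<subseteq> X" using that X by blast
    then show "inv\<^bsub>G\<^esub> x \<in> D" using that \<open>x \<in> D\<close> by (simp add: G_def Z.subspace_neg)
  qed (use that in \<open>auto simp: G_def Z.subspace_add Z.subspace_0\<close>)
  have carrier: "carrier H = C"
    unfolding H_def by (rule subgroup.carrier_subgroup_generated_subgroup[OF sub[OF C(1) subset_refl]])
  have mult: "x \<otimes>\<^bsub>H\<^esub> y = x + y" for x y by (simp add: H_def G_def)
  interpret H: comm_group H unfolding H_def by (rule G.abelian_subgroup_generated[OF G.comm_group_axioms])
  have subB: "subgroup B H"
    unfolding H_def G.subgroup_subgroup_generated_iff
    using sub[OF B] B(2) carrier by (simp add: H_def)
  interpret B: normal B H using subB by (simp add: H.normal_iff_subgroup)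
  interpret F: comm_group F unfolding F_def by (rule H.abelian_FactGroup[OF subB])
  have hom: "h (x + y) = h x \<otimes>\<^bsub>F\<^esub> h y" if "x \<in> C" "y \<in> C" for x y
    using hom_mult[OF B.r_coset_hom_Mod, of x y] that by (simp add: h_def F_def carrier mult)
  have h_in: "h x \<in> carrier F" if "x \<in> C" for x
    using that by (auto simp: h_def F_def carrier_FactGroup carrier)
  have h_one: "h x = \<one>\<^bsub>F\<^esub> \<longleftrightarrow> x \<in> B" if "x \<in> C" for x
    using that H.coset_join1[of B x] H.coset_join2[of x B] subB by (auto simp: h_def F_def carrier)
  have h_eq: "x - y \<in> B" if xy: "x \<in> C" "y \<in> C" "h x = h y" for x y
  proof -
    have y: "- y \<in> C" using xy Z.subspace_neg[OF C(1)] by blast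
    have "h (x + - y) = h (y + - y)" using xy y by (simp only: hom)
    also have "\<dots> = \<one>\<^bsub>F\<^esub>" using h_one[of 0] Z.subspace_0[OF C(1)] Z.subspace_0[OF B(1)] by simp
    finally show ?thesis using h_one[of "x + - y"] Z.subspace_add[OF C(1) xy(1) y] by simp
  qed
  have h_pow: "h x [^]\<^bsub>F\<^esub> n = h (frag_cmul n x)" if "x \<in> C" for x and n :: int
  proof -
    have "x [^]\<^bsub>H\<^esub> n = frag_cmul n x"
      unfolding H_def using that carrier X[OF that]
      by (subst G.int_pow_subgroup_generated) (simp_all add: H_def G_def)
    then show ?thesis using B.FactGroup_int_pow[of x n] that by (simp add: h_def F_def carrier)
  qed
  have comb: "(\<Sum>x\<in>S. frag_cmul (c x) x) \<in> C" if "S \<subseteq> C" for S c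
    using that by (intro Z.subspace_sum[OF C(1)] Z.subspace_scale[OF C(1)]) auto
  have finprod: "finprod F (\<lambda>x. h x [^]\<^bsub>F\<^esub> c x) S = h (\<Sum>x\<in>S. frag_cmul (c x) x)"
    if "finite S" "S \<subseteq> C" for S and c :: "_ \<Rightarrow> int"
    using that
  proof (induction S)
    case empty
    then show ?case using h_one[of 0] Z.subspace_0[OF C(1)] Z.subspace_0[OF B(1)] by simp
  next
    case (insert x S)
    have "(\<lambda>x. h x [^]\<^bsub>F\<^esub> c x) \<in> S \<rightarrow> carrier F" "h x [^]\<^bsub>F\<^esub> c x \<in> carrier F"
      using insert.prems h_in by (auto intro!: F.int_pow_closed)
    then have "finprod F (\<lambda>x. h x [^]\<^bsub>F\<^esub> c x) (insert x S)
        = h x [^]\<^bsub>F\<^esub> c x \<otimes>\<^bsub>F\<^esub> h (\<Sum>x\<in>S. frag_cmul (c x) x)"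
      using insert by simp
    also have "\<dots> = h (frag_cmul (c x) x + (\<Sum>x\<in>S. frag_cmul (c x) x))"
      using insert.prems comb[of S c] Z.subspace_scale[OF C(1)] by (simp add: h_pow hom)
    finally show ?case using insert.hyps by simp
  qed
  have finprod_image: "finprod F (\<lambda>y. y [^]\<^bsub>F\<^esub> c y) (h ` S) = h (\<Sum>x\<in>S. frag_cmul (c (h x)) x)"
    if "finite S" "S \<subseteq> C" "inj_on h S" for S and c :: "_ \<Rightarrow> int"
  proof -
    have "finprod F (\<lambda>y. y [^]\<^bsub>F\<^esub> c y) (h ` S) = finprod F (\<lambda>x. h x [^]\<^bsub>F\<^esub> c (h x)) S"
      using that h_in by (intro F.finprod_reindex) (auto intro!: F.int_pow_closed)
    then show ?thesis using finprod[OF that(1,2), of "\<lambda>x. c (h x)"] by simp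
  qed
  have upper: "card T \<le> lattice_rank C - lattice_rank B" if T: "int_independent F T" for T
  proof -
    have "T \<subseteq> h ` C" "finite T"
      using T by (auto simp: int_independent_def F_def carrier_FactGroup h_def carrier)
    then obtain S where S: "S \<subseteq> C" "inj_on h S" "T = h ` S"
      using subset_image_inj[of T h C] by auto
    have finS: "finite S" using \<open>finite T\<close> S(2,3) by (simp add: finite_image_iff)
    have "independent_modulo B S"
      unfolding independent_modulo_def
    proof (intro conjI allI impI ballI)
      fix c x assume inB: "(\<Sum>x\<in>S. frag_cmul (c x) x) \<in> B" and x: "x \<in> S"
      let ?d = "\<lambda>y. c (the_inv_into S h y)"
      have "finprod F (\<lambda>y. y [^]\<^bsub>F\<^esub> ?d y) T = h (\<Sum>x\<in>S. frag_cmul (c x) x)"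
        unfolding S(3) finprod_image[OF finS S(1,2)]
        by (rule arg_cong[of _ _ h], rule sum.cong) (simp_all add: the_inv_into_f_f[OF S(2)])
      then have "finprod F (\<lambda>y. y [^]\<^bsub>F\<^esub> ?d y) T = \<one>\<^bsub>F\<^esub>"
        using h_one[OF comb[OF S(1)]] inB by simp
      then have "\<forall>y\<in>T. ?d y = 0" using T unfolding int_independent_def by (elim conjE allE[of _ ?d]) (erule mp)
      then have "?d (h x) = 0" using x S(3) by simp
      then show "c x = 0" using x by (simp add: the_inv_into_f_f[OF S(2)])
    qed (fact finS)
    from independent_modulo_card_le[OF C(2) B S(1) this]
    show ?thesis by (simp add: S(3) card_image[OF S(2)])
  qed
  obtain S where S: "S \<subseteq> C" "independent_modulo B S" "card S + lattice_rank B = lattice_rank C"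
    using independent_modulo_attained[OF C(2) B(2)] by blast
  have injS: "inj_on h S"
    using independent_modulo_eq[OF S(2)] h_eq S(1) by (intro inj_onI) blast
  have finS: "finite S" using S(2) by (simp add: independent_modulo_def)
  have "int_independent F (h ` S)"
    unfolding int_independent_def
  proof (intro conjI allI impI ballI)
    fix c :: "_ \<Rightarrow> int" and y
    assume "finprod F (\<lambda>y. y [^]\<^bsub>F\<^esub> c y) (h ` S) = \<one>\<^bsub>F\<^esub>" and y: "y \<in> h ` S"
    then have "(\<Sum>x\<in>S. frag_cmul (c (h x)) x) \<in> B"
      using h_one[OF comb[OF S(1)]] finprod_image[OF finS S(1) injS] by simp
    from independent_moduloD[OF S(2) this] y show "c y = 0" by blast
  qed (use finS S(1) h_in in auto)
  then have "lattice_rank C - lattice_rank B \<in> {card S |S. int_independent F S}"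
    using S(3) card_image[OF injS] by (intro CollectI exI[of _ "h ` S"]) auto
  then have "Sup {card S |S. int_independent F S} = lattice_rank C - lattice_rank B"
    by (rule cSup_eq_maximum) (use upper in auto)
  then show ?thesis by (simp add: abelian_rank_def F_def H_def G_def)
qed

section \<open>The Euler-Poincare formula\<close>

lemma chains_in_span: "{c. Poly_Mapping.keys c \<subseteq> X} \<subseteq> Z.span (frag_of ` X)"
proof safe
  fix c :: "'a \<Rightarrow>\<^sub>0 int" assume "Poly_Mapping.keys c \<subseteq> X"
  then show "c \<in> Z.span (frag_of ` X)"
    by (induction rule: free_Abelian_group_induct[consumes 1, where S = X]) (auto intro: Z.span_zero Z.span_diff Z.span_base)
qed

lemma subspace_chains: "Z.subspace {c. Poly_Mapping.keys c \<subseteq> X}"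
  by (auto simp: Z.subspace_def dest: subsetD[OF keys_add] subsetD[OF keys_cmul])

lemma lookup_sum_frag_of:
  assumes "finite X" "x \<in> X"
  shows "Poly_Mapping.lookup (\<Sum>x\<in>X. frag_cmul (c x) (frag_of x)) x = c x"
proof -
  have "Poly_Mapping.lookup (\<Sum>y\<in>X. frag_cmul (c y) (frag_of y)) x = (\<Sum>y\<in>X. if y = x then c y else 0)"
    by (simp add: lookup_sum) (rule sum.cong, auto simp: lookup_frag_of)
  then show ?thesis using assms by simp
qed

lemma lattice_rank_chains:
  assumes X: "finite X"
  shows "finite_rank {c. Poly_Mapping.keys c \<subseteq> X}"
    and "lattice_rank {c. Poly_Mapping.keys c \<subseteq> X} = card X"
proof -
  let ?C = "{c :: 'a \<Rightarrow>\<^sub>0 int. Poly_Mapping.keys c \<subseteq> X}"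
  show fr: "finite_rank ?C" unfolding finite_rank_def
    using X chains_in_span[of X] by (intro exI[of _ "frag_of ` X"]) auto
  have inj: "inj_on (frag_of :: 'a \<Rightarrow> 'a \<Rightarrow>\<^sub>0 int) X" by (auto simp: inj_on_def frag_of_eq)
  have "independent_modulo {0} (frag_of ` X)"
    unfolding independent_modulo_def
  proof (intro conjI allI impI ballI)
    fix c y assume "(\<Sum>x\<in>frag_of ` X. frag_cmul (c x) x) \<in> {0}" and y: "y \<in> frag_of ` X"
    then have "(\<Sum>x\<in>X. frag_cmul (c (frag_of x)) (frag_of x)) = 0" by (simp add: sum.reindex[OF inj])
    then show "c y = 0" using y lookup_sum_frag_of[OF X, of _ "\<lambda>x. c (frag_of x)"] by fastforce
  qed (use X in auto)
  then have "card X \<le> lattice_rank ?C"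
    using independent_card_le_lattice_rank[OF fr, of "frag_of ` X"] by (simp add: card_image[OF inj] image_subset_iff)
  moreover have "rat_vec ` ?C \<subseteq> Q.span (rat_vec ` frag_of ` X)"
    using chains_in_span[of X] rat_vec_span[of "frag_of ` X"] by blast
  then have "lattice_rank ?C \<le> card (rat_vec ` frag_of ` X)"
    unfolding lattice_rank_def using X by (intro Q.dim_le_card) auto
  then have "lattice_rank ?C \<le> card X"
    using card_image_le[OF X, of frag_of] card_image_le[of "frag_of ` X" rat_vec] X by fastforce
  ultimately show "lattice_rank ?C = card X" by simp
qed

lemma finite_rank_subset: "finite_rank A \<Longrightarrow> B \<subseteq> A \<Longrightarrow> finite_rank B"
  unfolding finite_rank_def by blast

lemma lattice_rank_mono:
  assumes "finite_rank A" "B \<subseteq> A"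
  shows "lattice_rank B \<le> lattice_rank A"
proof -
  obtain S where "S \<subseteq> A" "independent_modulo B S" "card S + lattice_rank B = lattice_rank A"
    by (rule independent_modulo_attained[OF assms])
  then show ?thesis by linarith
qed

lemma alternating_telescope:
  "(\<Sum>i<n. (-1) ^ i * (b i + b (Suc i))) = b 0 - (-1) ^ n * (b n :: int)"
  by (induction n) (auto simp: algebra_simps)

text \<open>Let \<open>c\<close>, \<open>z\<close> and \<open>b\<close> be the ranks of chains, cycles and boundaries, indexed by the
  number of vertices. Then \<open>c (i+1) = z (i+1) + b i\<close>, so the ranks \<open>z (i+1) - b (i+1)\<close> of the
  homology groups equal \<open>c (i+1) - (b i + b (i+1))\<close>, and the alternating sum of the brackets
  telescopes to \<open>b 0\<close>. A vertex is needed because it makes the augmentation surjective, so that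
  \<open>b 0 = 1\<close> accounts for the empty simplex; the complex whose only simplex is the empty one has
  homology in degree \<open>-1\<close>, which the sum over \<open>i \<ge> 0\<close> does not see.\<close>

lemma reduced_euler_characteristic_alternating_sum:
  fixes K :: "'a set set"
  assumes finK: "finite K" and fin: "\<And>\<sigma>. \<sigma> \<in> K \<Longrightarrow> finite \<sigma>"
    and closed: "\<And>\<sigma> \<tau>. \<sigma> \<in> K \<Longrightarrow> \<tau> \<subseteq> \<sigma> \<Longrightarrow> \<tau> \<in> K"
    and chain: "\<And>\<sigma>. \<sigma> \<in> K \<Longrightarrow> Complete_Partial_Order.chain r \<sigma>"
    and antisym: "\<And>\<sigma> x y. \<sigma> \<in> K \<Longrightarrow> x \<in> \<sigma> \<Longrightarrow> y \<in> \<sigma> \<Longrightarrow> r x y \<Longrightarrow> r y x \<Longrightarrow> x = y"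
    and vertex: "{v} \<in> K"
  shows "reduced_euler_characteristic r K = - (\<Sum>\<sigma>\<in>K. (-1) ^ card \<sigma>)"
proof -
  let ?d = "simplicial_boundary r"
  define X where "X i = {\<sigma> \<in> K. card \<sigma> = i}" for i
  define C where "C i = {c :: 'a set \<Rightarrow>\<^sub>0 int. Poly_Mapping.keys c \<subseteq> X i}" for i
  define Cy where "Cy i = {c \<in> C i. ?d c = 0}" for i
  define Bd where "Bd i = ?d ` C (Suc i)" for i
  define z where "z i = lattice_rank (Cy i)" for i
  define b where "b i = lattice_rank (Bd i)" for i
  have finX: "finite (X i)" for i using finK by (simp add: X_def)
  have C: "Z.subspace (C i)" "finite_rank (C i)" "lattice_rank (C i) = card (X i)" for i
    using subspace_chains lattice_rank_chains[OF finX] by (simp_all add: C_def)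
  have d_add: "?d (x + y) = ?d x + ?d y" and d_cmul: "?d (frag_cmul n x) = frag_cmul n (?d x)" for x y n
    by (simp_all add: simplicial_boundary_def frag_extend_add frag_extend_cmul)
  have d_simplex: "simplex_boundary r \<sigma> \<in> C i" if "\<sigma> \<in> X (Suc i)" for \<sigma> i
  proof -
    have "frag_of (\<sigma> - {v}) \<in> C i" if "v \<in> \<sigma>" for v
      using that \<open>\<sigma> \<in> X (Suc i)\<close> closed fin by (auto simp: C_def X_def)
    then show ?thesis unfolding simplex_boundary_def
      by (intro Z.subspace_sum[OF C(1)] Z.subspace_scale[OF C(1)])
  qed
  have d_C: "?d c \<in> C i" and d_d: "?d (?d c) = 0" if "c \<in> C (Suc i)" for c i
  proof -
    have "Poly_Mapping.keys c \<subseteq> X (Suc i)" using that by (simp add: C_def)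
    then have "?d c \<in> C i \<and> ?d (?d c) = 0"
    proof (induction rule: free_Abelian_group_induct[consumes 1, where S = "X (Suc i)"])
      case (3 \<sigma>)
      then have "\<sigma> \<in> K" by (simp add: X_def)
      then have "?d (simplex_boundary r \<sigma>) = 0"
        using fin chain antisym by (intro simplex_boundary_boundary) blast+
      then show ?case using d_simplex[OF 3] by (simp add: simplicial_boundary_def)
    qed (simp_all add: simplicial_boundary_def frag_extend_diff Z.subspace_diff[OF C(1)] Z.subspace_0[OF C(1)])
    then show "?d c \<in> C i" "?d (?d c) = 0" by auto
  qed
  interpret d: Modules.module_hom frag_cmul frag_cmul ?d
    using d_add d_cmul by unfold_locales
  have sub: "Z.subspace (Cy i)" "Z.subspace (Bd i)" "Cy i \<subseteq> C i" "Bd (Suc i) \<subseteq> Cy (Suc i)" for i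
  proof -
    show "Z.subspace (Cy i)" using C(1)[of i] by (auto simp: Z.subspace_def Cy_def d_add d_cmul)
    show "Z.subspace (Bd i)" unfolding Bd_def by (rule d.subspace_image[OF C(1)])
    show "Cy i \<subseteq> C i" by (auto simp: Cy_def)
    show "Bd (Suc i) \<subseteq> Cy (Suc i)" using d_C d_d by (auto simp: Bd_def Cy_def)
  qed
  have nullity: "card (X (Suc i)) = z (Suc i) + b i" for i
    using rank_nullity[OF C(2,1) _ d_cmul, of "Suc i"] d_add
    by (simp add: C(3) z_def b_def Cy_def Bd_def additive_def)
  have homology: "abelian_rank (reduced_simplicial_homology r K i) = z (Suc i) - b (Suc i)" for i
  proof -
    have "reduced_simplicial_homology r K i =
        subgroup_generated (free_Abelian_group (X (Suc i))) (Cy (Suc i)) Mod Bd (Suc i)"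
      unfolding reduced_simplicial_homology_def simplicial_cycles_def simplicial_boundaries_def
        simplicial_chain_group_def
      by (simp add: X_def Cy_def Bd_def C_def free_Abelian_group_def)
    moreover have "finite_rank (Cy (Suc i))" using C(2) sub(3) finite_rank_subset by blast
    ultimately show ?thesis
      using abelian_rank_quotient[OF sub(1) _ _ sub(2,4), of i "X (Suc i)"] sub(3)[of "Suc i"]
      by (auto simp: z_def b_def C_def)
  qed
  have b_le: "b (Suc i) \<le> z (Suc i)" for i
    unfolding b_def z_def using C(2) sub(3,4) finite_rank_subset by (intro lattice_rank_mono) blast+
  have X0: "X 0 = {{}}" using closed[OF vertex, of "{}"] fin by (auto simp: X_def)
  have b0: "b 0 = 1"
  proof -
    have "C 0 \<subseteq> Bd 0"
    proof
      fix c assume "c \<in> C 0"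
      then have "Poly_Mapping.keys c \<subseteq> {{}}" by (simp add: C_def X0)
      then show "c \<in> Bd 0"
      proof (induction rule: free_Abelian_group_induct[consumes 1, where S = "{{}}"])
        case (3 \<sigma>)
        have "?d (frag_of {v}) = frag_of {}"
          by (simp add: simplicial_boundary_def simplex_boundary_def cong: conj_cong)
        moreover have "frag_of {v} \<in> C (Suc 0)" using vertex by (simp add: C_def X_def)
        ultimately show ?case using 3 unfolding Bd_def by (metis image_eqI singletonD)
      qed (use sub(2) in \<open>auto intro: Z.subspace_0 Z.subspace_diff\<close>)
    qed
    then have "C 0 = Bd 0" using d_C by (auto simp: Bd_def)
    then show ?thesis using C(3)[of 0] by (simp add: b_def X0)
  qed
  \<comment> \<open>No simplex has more than \<open>N\<close> vertices, so all ranks vanish from there on.\<close>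
  define N where "N = Max (card ` K)"
  have XN: "X i = {}" if "N < i" for i
    using that finK Max_ge[of "card ` K"] unfolding N_def X_def by (fastforce simp: not_less[symmetric])
  have zN: "z (Suc i) = 0" and bN: "b i = 0" if "N \<le> i" for i
    using nullity[of i] XN[of "Suc i"] that by auto
  have "reduced_euler_characteristic r K = (\<Sum>i<N. (-1) ^ i * int (z (Suc i) - b (Suc i)))"
    unfolding reduced_euler_characteristic_def homology
    by (rule Sum_any.expand_superset) (use zN in \<open>force simp: not_less intro: ccontr\<close>)+
  also have "\<dots> = (\<Sum>i<N. (-1) ^ i * int (card (X (Suc i))) - (-1) ^ i * (int (b i) + int (b (Suc i))))"
    using b_le by (intro sum.cong) (auto simp: nullity of_nat_diff algebra_simps)
  also have "\<dots> = (\<Sum>i<N. (-1) ^ i * int (card (X (Suc i)))) - int (b 0)"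
    unfolding sum_subtractf alternating_telescope[of "\<lambda>i. int (b i)"] using bN[of N] by simp
  also have "\<dots> = - (\<Sum>i<Suc N. (-1) ^ i * int (card (X i)))"
    unfolding sum.lessThan_Suc_shift
    by (simp add: sum_negf X0 b0)
  also have "(\<Sum>i<Suc N. (-1) ^ i * int (card (X i))) = (\<Sum>i<Suc N. \<Sum>\<sigma> | \<sigma> \<in> K \<and> card \<sigma> = i. (-1) ^ card \<sigma>)"
    by (intro sum.cong) (auto simp: X_def)
  also have "\<dots> = (\<Sum>\<sigma>\<in>K. (-1) ^ card \<sigma>)"
    using finK by (intro sum.group) (auto simp: N_def less_Suc_eq_le)
  finally show ?thesis .
qed

section \<open>The Moebius function of the poset of proper divisors\<close>

text \<open>A nonempty finite chain is its greatest element \<open>q\<close> together with an arbitrary chain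
  strictly below \<open>q\<close>; adjoining \<open>q\<close> flips the sign. The summand \<open>1\<close> is the empty chain.\<close>

lemma order_complex_alternating_sum:
  fixes r :: "'a \<Rightarrow> 'a \<Rightarrow> bool"
  assumes finX: "finite X"
    and refl: "\<And>x. x \<in> X \<Longrightarrow> r x x"
    and trans: "\<And>x y z. x \<in> X \<Longrightarrow> y \<in> X \<Longrightarrow> z \<in> X \<Longrightarrow> r x y \<Longrightarrow> r y z \<Longrightarrow> r x z"
    and antisym: "\<And>x y. x \<in> X \<Longrightarrow> y \<in> X \<Longrightarrow> r x y \<Longrightarrow> r y x \<Longrightarrow> x = y"
  shows "(\<Sum>\<sigma>\<in>order_complex r X. (-1) ^ card \<sigma> :: int) =
    1 - (\<Sum>q\<in>X. \<Sum>\<tau>\<in>order_complex r {x \<in> X. r x q \<and> x \<noteq> q}. (-1) ^ card \<tau>)"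
proof -
  let ?L = "\<lambda>q. order_complex r {x \<in> X. r x q \<and> x \<noteq> q}"
  let ?P = "SIGMA q:X. ?L q"
  have fin: "finite (order_complex r Y)" if "Y \<subseteq> X" for Y
    using finite_subset[of "order_complex r Y" "Pow X"] finX that
    by (auto simp: order_complex_def)
  have greatest: "\<exists>q\<in>\<sigma>. \<forall>x\<in>\<sigma>. r x q"
    if "finite \<sigma>" "\<sigma> \<noteq> {}" "\<sigma> \<subseteq> X" "Complete_Partial_Order.chain r \<sigma>" for \<sigma>
    using that
  proof (induction \<sigma> rule: finite_ne_induct)
    case (singleton x)
    then show ?case using refl by simp
  next
    case (insert y \<sigma>)
    then obtain q where q: "q \<in> \<sigma>" "\<forall>x\<in>\<sigma>. r x q"
      using chain_subset[of r "insert y \<sigma>" \<sigma>] by auto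
    have "r y q \<or> r q y" using insert.prems(2) q(1) by (auto simp: chain_def)
    moreover have "\<forall>x\<in>insert y \<sigma>. r x y" if "r q y"
      using q that trans[of _ q y] refl[of y] insert.prems(1) by blast
    ultimately show ?case using q by blast
  qed
  have "bij_betw (\<lambda>(q, \<tau>). insert q \<tau>) ?P (order_complex r X - {{}})"
    unfolding bij_betw_def
  proof
    show "inj_on (\<lambda>(q, \<tau>). insert q \<tau>) ?P"
    proof (rule inj_onI, clarify)
      fix q \<tau> q' \<tau>'
      assume "q \<in> X" "\<tau> \<in> ?L q" "q' \<in> X" "\<tau>' \<in> ?L q'" and eq: "insert q \<tau> = insert q' \<tau>'"
      then have sub: "q \<in> X" "q' \<in> X" "\<tau> \<subseteq> {x \<in> X. r x q \<and> x \<noteq> q}" "\<tau>' \<subseteq> {x \<in> X. r x q' \<and> x \<noteq> q'}"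
        by (auto simp: order_complex_def)
      have "q = q'"
      proof (rule ccontr)
        assume "q \<noteq> q'"
        have "q \<in> insert q' \<tau>'" "q' \<in> insert q \<tau>"
          using eq insertI1[of q \<tau>] insertI1[of q' \<tau>'] by simp_all
        with \<open>q \<noteq> q'\<close> have "q \<in> \<tau>'" "q' \<in> \<tau>" by simp_all
        then have "r q q'" "r q' q" using sub(3,4) by auto
        with antisym sub(1,2) \<open>q \<noteq> q'\<close> show False by blast
      qed
      moreover have "q \<notin> \<tau>" "q' \<notin> \<tau>'" using sub(3,4) by auto
      ultimately show "q = q' \<and> \<tau> = \<tau>'" using eq by (simp add: insert_ident)
    qed
    show "(\<lambda>(q, \<tau>). insert q \<tau>) ` ?P = order_complex r X - {{}}"
    proof (intro equalityI subsetI)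
      fix \<sigma> assume "\<sigma> \<in> (\<lambda>(q, \<tau>). insert q \<tau>) ` ?P"
      then show "\<sigma> \<in> order_complex r X - {{}}"
        using refl by (auto simp: order_complex_def chain_def)
    next
      fix \<sigma> assume \<sigma>: "\<sigma> \<in> order_complex r X - {{}}"
      then obtain q where q: "q \<in> \<sigma>" "\<forall>x\<in>\<sigma>. r x q"
        using greatest[of \<sigma>] by (auto simp: order_complex_def)
      have "\<sigma> - {q} \<in> ?L q"
        using \<sigma> q by (auto simp: order_complex_def chain_def)
      moreover have "q \<in> X" using \<sigma> q(1) by (auto simp: order_complex_def)
      ultimately have "(q, \<sigma> - {q}) \<in> ?P" by simp
      moreover have "\<sigma> = (\<lambda>(q, \<tau>). insert q \<tau>) (q, \<sigma> - {q})" using insert_Diff[OF q(1)] by simp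
      ultimately show "\<sigma> \<in> (\<lambda>(q, \<tau>). insert q \<tau>) ` ?P" by (rule rev_image_eqI)
    qed
  qed
  from sum.reindex_bij_betw[OF this, of "\<lambda>\<sigma>. (-1) ^ card \<sigma> :: int"]
  have "(\<Sum>\<sigma>\<in>order_complex r X - {{}}. (-1) ^ card \<sigma> :: int)
      = (\<Sum>(q, \<tau>)\<in>?P. (-1) ^ card (insert q \<tau>))"
    by (simp only: case_prod_unfold)
  also have "\<dots> = (\<Sum>(q, \<tau>)\<in>?P. - ((-1) ^ card \<tau>))"
  proof (rule sum.cong, simp, clarify)
    fix q \<tau> assume "\<tau> \<in> ?L q"
    then have "finite \<tau>" "q \<notin> \<tau>" by (auto simp: order_complex_def)
    then show "(-1) ^ card (insert q \<tau>) = - ((-1) ^ card \<tau> :: int)" by simp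
  qed
  also have "\<dots> = - (\<Sum>q\<in>X. \<Sum>\<tau>\<in>?L q. (-1) ^ card \<tau>)"
    using finX fin by (subst sum.Sigma[symmetric]) (auto simp: sum_negf)
  finally have "(\<Sum>\<sigma>\<in>order_complex r X - {{}}. (-1) ^ card \<sigma> :: int) = - (\<Sum>q\<in>X. \<Sum>\<tau>\<in>?L q. (-1) ^ card \<tau>)" .
  moreover have "{} \<in> order_complex r X" by (simp add: order_complex_def chain_def)
  ultimately show ?thesis using fin[OF subset_refl] by (simp add: sum.remove)
qed

definition pd_chain_sum :: "nat \<Rightarrow> nat \<Rightarrow> int" where
  "pd_chain_sum a b = (\<Sum>\<sigma>\<in>pd_order_complex a b. (-1) ^ card \<sigma>)"

lemma pd_interval: "pd_poset a b - {(0, 0), (a, b)} = {q. properly_divides q (a, b)} - {(0, 0), (a, b)}"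
  by (auto simp: pd_poset_def pd_le_def)

lemma finite_proper_divisors: "finite {q. properly_divides q (a, b)}"
  by (rule finite_subset[of _ "{..a} \<times> {..b}"]) (auto simp: properly_divides_def)

lemma pd_chain_sum_rec:
  "pd_chain_sum a b = 1 - (\<Sum>(c, d)\<in>{q. properly_divides q (a, b)} - {(0, 0), (a, b)}. pd_chain_sum c d)"
proof -
  interpret order pd_le "\<lambda>p q. pd_le p q \<and> \<not> pd_le q p" by (rule pd_le_partial_order)
  let ?X = "pd_poset a b - {(0, 0), (a, b)}"
  have low: "{x \<in> ?X. pd_le x (c, d) \<and> x \<noteq> (c, d)} = pd_poset c d - {(0, 0), (c, d)}"
    if "(c, d) \<in> ?X" for c d
  proof -
    have cd: "pd_le (c, d) (a, b)" "(c, d) \<noteq> (a, b)" using that by (auto simp: pd_poset_def)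
    have "pd_le x (a, b) \<and> x \<noteq> (a, b)" if "pd_le x (c, d)" for x
      using order_trans[OF that cd(1)] order_antisym[OF cd(1)] that cd(2) by auto
    then show ?thesis by (auto simp: pd_poset_def)
  qed
  have "pd_chain_sum a b = 1 - (\<Sum>q\<in>?X. \<Sum>\<tau>\<in>order_complex pd_le {x \<in> ?X. pd_le x q \<and> x \<noteq> q}. (-1) ^ card \<tau>)"
    unfolding pd_chain_sum_def pd_order_complex_def
  proof (rule order_complex_alternating_sum)
    show "finite ?X" using finite_proper_divisors[of a b] by (simp add: pd_interval)
  qed (blast intro: order_refl order_trans order_antisym)+
  also have "(\<Sum>q\<in>?X. \<Sum>\<tau>\<in>order_complex pd_le {x \<in> ?X. pd_le x q \<and> x \<noteq> q}. (-1) ^ card \<tau>)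
      = (\<Sum>(c, d)\<in>?X. pd_chain_sum c d)"
    unfolding pd_chain_sum_def pd_order_complex_def
  proof (rule sum.cong[OF refl])
    fix q assume "q \<in> ?X"
    then obtain c d where q: "q = (c, d)" "(c, d) \<in> ?X" by (cases q) auto
    from low[OF q(2)] have "(\<Sum>\<tau>\<in>order_complex pd_le {x \<in> ?X. pd_le x (c, d) \<and> x \<noteq> (c, d)}. (-1) ^ card \<tau> :: int)
      = (\<Sum>\<sigma>\<in>order_complex pd_le (pd_poset c d - {(0, 0), (c, d)}). (-1) ^ card \<sigma>)" by (simp only:)
    then show "(\<Sum>\<tau>\<in>order_complex pd_le {x \<in> ?X. pd_le x q \<and> x \<noteq> q}. (-1) ^ card \<tau> :: int)
      = (case q of (c, d) \<Rightarrow> \<Sum>\<sigma>\<in>order_complex pd_le (pd_poset c d - {(0, 0), (c, d)}). (-1) ^ card \<sigma>)"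
      by (simp only: q(1) prod.case)
  qed
  finally show ?thesis by (simp add: pd_interval)
qed

text \<open>The Moebius function of the interval from \<open>(0, 0)\<close> to \<open>(a, b)\<close>, by Philip Hall's formula:
  minus the alternating sum over the chains of the open interval. The formula presupposes distinct
  end points, so the value \<open>1\<close> at the origin is set by hand.\<close>

definition pd_mobius :: "nat \<Rightarrow> nat \<Rightarrow> int" where
  "pd_mobius a b = (if a = 0 \<and> b = 0 then 1 else - pd_chain_sum a b)"

text \<open>The recursion for the chain sums, with the summand \<open>1\<close> of the empty chain absorbed as
  the value at the origin.\<close>

lemma pd_mobius_sum:
  assumes "(a, b) \<noteq> (0, 0)"
  shows "pd_mobius a b = - (\<Sum>(c, d)\<in>{q. properly_divides q (a, b)} - {(a, b)}. pd_mobius c d)"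
proof -
  let ?D = "{q. properly_divides q (a, b)} - {(a, b)}"
  have "(0, 0) \<in> ?D" using assms by (auto simp: properly_divides_def)
  then have "(\<Sum>(c, d)\<in>?D. pd_mobius c d) = 1 + (\<Sum>(c, d)\<in>?D - {(0, 0)}. pd_mobius c d)"
    using finite_proper_divisors[of a b] by (subst sum.remove[of _ "(0, 0)"]) (auto simp: pd_mobius_def)
  also have "(\<Sum>(c, d)\<in>?D - {(0, 0)}. pd_mobius c d) = - (\<Sum>(c, d)\<in>?D - {(0, 0)}. pd_chain_sum c d)"
    unfolding sum_negf[symmetric] by (rule sum.cong) (auto simp: pd_mobius_def split: if_splits)
  also have "?D - {(0, 0)} = {q. properly_divides q (a, b)} - {(0, 0), (a, b)}" by auto
  finally have "(\<Sum>(c, d)\<in>?D. pd_mobius c d) = pd_chain_sum a b"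
    by (subst pd_chain_sum_rec) simp
  moreover have "pd_mobius a b = - pd_chain_sum a b" using assms by (auto simp: pd_mobius_def)
  ultimately show ?thesis by simp
qed

lemma pd_mobius_0_left: "pd_mobius 0 b = (if b = 0 then 1 else if b = 1 then -1 else 0)"
proof (induction b rule: less_induct)
  case (less b)
  show ?case
  proof (cases "b = 0")
    case False
    have "{q. properly_divides q (0, b)} - {(0, b)} = Pair 0 ` {..<b}"
      using False by (auto simp: properly_divides_def)
    then have "pd_mobius 0 b = - (\<Sum>d<b. pd_mobius 0 d)"
      using pd_mobius_sum[of 0 b] False by (simp add: sum.reindex inj_on_def)
    also have "(\<Sum>d<b. pd_mobius 0 d) = (\<Sum>d<b. (if d = 0 then 1 else 0) - (if d = 1 then 1 else 0))"
      using less by (intro sum.cong) auto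
    also have "\<dots> = (if b = 1 then 1 else 0)"
      using False by (simp add: sum_subtractf)
    finally show ?thesis using False by simp
  qed (simp add: pd_mobius_def)
qed

lemma pd_mobius_0_right: "pd_mobius a 0 = (if a = 0 then 1 else if a = 1 then -1 else 0)"
proof (induction a rule: less_induct)
  case (less a)
  show ?case
  proof (cases "a = 0")
    case False
    have "{q. properly_divides q (a, 0)} - {(a, 0)} = (\<lambda>c. (c, 0)) ` {..<a}"
      using False by (auto simp: properly_divides_def)
    then have "pd_mobius a 0 = - (\<Sum>c<a. pd_mobius c 0)"
      using pd_mobius_sum[of a 0] False by (simp add: sum.reindex inj_on_def)
    also have "(\<Sum>c<a. pd_mobius c 0) = (\<Sum>c<a. (if c = 0 then 1 else 0) - (if c = 1 then 1 else 0))"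
      using less by (intro sum.cong) auto
    also have "\<dots> = (if a = 1 then 1 else 0)"
      using False by (simp add: sum_subtractf)
    finally show ?thesis using False by simp
  qed (simp add: pd_mobius_def)
qed

lemma pd_mobius_Suc_Suc:
  "pd_mobius (Suc a) (Suc b) = - (\<Sum>c\<le>a. \<Sum>d\<le>b. pd_mobius c d)"
proof -
  have "{q. properly_divides q (Suc a, Suc b)} - {(Suc a, Suc b)} = {..a} \<times> {..b}"
    by (auto simp: properly_divides_def)
  then show ?thesis using pd_mobius_sum[of "Suc a" "Suc b"] by (simp add: sum.cartesian_product)
qed

lemma pd_mobius_1_left: "pd_mobius 1 (Suc b) = (if b = 0 then -1 else 0)"
proof -
  have "(\<Sum>d\<le>b. pd_mobius 0 d) = (\<Sum>d\<le>b. (if d = 0 then 1 else 0) - (if d = 1 then 1 else 0))"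
    by (rule sum.cong) (auto simp: pd_mobius_0_left)
  also have "\<dots> = (if b = 0 then 1 else 0)" by (simp add: sum_subtractf)
  finally show ?thesis using pd_mobius_Suc_Suc[of 0 b] by simp
qed

lemma pd_mobius_1_right: "pd_mobius (Suc a) 1 = (if a = 0 then -1 else 0)"
proof -
  have "(\<Sum>c\<le>a. pd_mobius c 0) = (\<Sum>c\<le>a. (if c = 0 then 1 else 0) - (if c = 1 then 1 else 0))"
    by (rule sum.cong) (auto simp: pd_mobius_0_right)
  also have "\<dots> = (if a = 0 then 1 else 0)" by (simp add: sum_subtractf)
  finally show ?thesis using pd_mobius_Suc_Suc[of a 0] by simp
qed

text \<open>The mixed second difference of the sums over rectangles \<open>{..a} \<times> {..b}\<close> leaves only the
  corner term.\<close>

lemma pd_mobius_recurrence: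
  "pd_mobius (Suc (Suc a)) (Suc (Suc b)) =
    pd_mobius (Suc (Suc a)) (Suc b) + pd_mobius (Suc a) (Suc (Suc b)) - 2 * pd_mobius (Suc a) (Suc b)"
  unfolding pd_mobius_Suc_Suc[of "Suc a"] pd_mobius_Suc_Suc[of a "Suc b"]
  by (simp add: sum.distrib pd_mobius_Suc_Suc[of a b])

section \<open>Solving the recurrence\<close>

text \<open>The value at \<open>n\<close> of the binary Krawtchouk polynomial of degree \<open>m\<close> and length
  \<open>m + n\<close>.\<close>

definition krawtchouk :: "nat \<Rightarrow> nat \<Rightarrow> int" where
  "krawtchouk m n = coeff ([:1, -1:] ^ n * [:1, 1:] ^ m) m"

lemma coeff_linear_mult_Suc:
  "coeff ([:1, c:] * p) (Suc k) = coeff p (Suc k) + c * coeff p k" for p :: "int poly"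
  by (simp add: mult_pCons_left)

lemma coeff_linear_mult_0: "coeff ([:1, c:] * p) 0 = coeff p 0" for p :: "int poly"
  by (simp add: mult_pCons_left)

lemma krawtchouk_0_left: "krawtchouk 0 n = 1"
  by (simp add: krawtchouk_def coeff_0_power)

lemma krawtchouk_0_right: "krawtchouk m 0 = 1"
  by (simp add: krawtchouk_def coeff_linear_power)

text \<open>All four polynomials are multiples of \<open>p = (1 - x)\<^sup>n (1 + x)\<^sup>m\<close> by a factor \<open>1\<close>, \<open>1 - x\<close>,
  \<open>1 + x\<close> or \<open>1 - x\<^sup>2\<close>. In terms of the coefficients \<open>p\<^sub>k\<close> both sides are \<open>p\<^bsub>m + 1\<^esub> - p\<^bsub>m - 1\<^esub>\<close>.\<close>

lemma krawtchouk_recurrence: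
  "krawtchouk (Suc m) (Suc n) = krawtchouk (Suc m) n + krawtchouk m (Suc n) - 2 * krawtchouk m n"
proof -
  define p :: "int poly" where "p = [:1, -1:] ^ n * [:1, 1:] ^ m"
  have 1: "[:1, -1:] ^ n * [:1, 1:] ^ Suc m = [:1, 1:] * p"
    and 2: "[:1, -1:] ^ Suc n * [:1, 1:] ^ m = [:1, -1:] * p"
    and 3: "[:1, -1:] ^ Suc n * [:1, 1:] ^ Suc m = [:1, -1:] * ([:1, 1:] * p)"
    by (simp_all only: p_def power_Suc ac_simps)
  show ?thesis
    unfolding krawtchouk_def 1 2 3 p_def[symmetric]
    by (cases m) (simp_all only: coeff_linear_mult_Suc coeff_linear_mult_0, simp_all)
qed

text \<open>The recurrence for \<open>pd_mobius\<close> reaches down to the lines where one coordinate is \<open>1\<close>. There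
  the only nonzero value is \<open>-1\<close> at \<open>(1, 1)\<close>, and the term \<open>-2 \<cdot> (-1)\<close> that it contributes at
  \<open>(2, 2)\<close> is the source of the factor \<open>2\<close>; along the lines where one coordinate is \<open>2\<close> this value
  is then copied.\<close>

lemma pd_mobius_eq_krawtchouk: "pd_mobius (m + 2) (n + 2) = 2 * krawtchouk m n"
proof (induction m arbitrary: n)
  case 0
  show ?case
  proof (induction n)
    case 0
    show ?case using pd_mobius_recurrence[of 0 0] pd_mobius_1_left[of 0] pd_mobius_1_left[of 1] pd_mobius_1_right[of 1]
      by (simp add: krawtchouk_0_left numeral_2_eq_2)
  next
    case (Suc n)
    then show ?case using pd_mobius_recurrence[of 0 "Suc n"] pd_mobius_1_left[of "Suc n"] pd_mobius_1_left[of "Suc (Suc n)"]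
      by (simp add: krawtchouk_0_left numeral_2_eq_2)
  qed
next
  case (Suc m)
  show ?case
  proof (induction n)
    case 0
    then show ?case using Suc[of 0] pd_mobius_recurrence[of "Suc m" 0] pd_mobius_1_right[of "Suc m"] pd_mobius_1_right[of "Suc (Suc m)"]
      by (simp add: krawtchouk_0_right numeral_2_eq_2)
  next
    case (Suc n)
    then show ?case using \<open>\<And>n. pd_mobius (m + 2) (n + 2) = 2 * krawtchouk m n\<close>[of n]
        \<open>\<And>n. pd_mobius (m + 2) (n + 2) = 2 * krawtchouk m n\<close>[of "Suc n"]
        pd_mobius_recurrence[of "Suc m" "Suc n"]
      by (simp add: krawtchouk_recurrence numeral_2_eq_2)
  qed
qed

lemma coeff_one_minus_power: "coeff ([:1, -1:] ^ k) i = (-1) ^ i * (of_nat (k choose i) :: int)"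
proof (cases "i \<le> k")
  case True
  then show ?thesis by (simp add: coeff_linear_poly_power)
next
  case False
  then have "degree ([:1, -1:] ^ k :: int poly) < i"
    using degree_power_le[of "[:1, -1:] :: int poly" k] by simp
  then show ?thesis using False by (simp add: coeff_eq_0)
qed

text \<open>For \<open>m \<le> n\<close> every factor \<open>1 + x\<close> can be paired with a factor \<open>1 - x\<close>.\<close>

lemma krawtchouk_eq_sum:
  assumes "m \<le> n"
  shows "krawtchouk m n =
    (-1) ^ m * (\<Sum>h = 0..m div 2. (-1) ^ h * int (m choose h) * int ((n - m) choose (m - 2 * h)))"
proof -
  have "[:1, -1:] * [:1, 1:] = (1 + monom (-1) 2 :: int poly)"
    by (simp add: monom_altdef numeral_2_eq_2 one_pCons)
  moreover have "[:1, -1:] ^ n * [:1, 1:] ^ m = ([:1, -1:] * [:1, 1:]) ^ m * ([:1, -1:] ^ (n - m) :: int poly)"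
  proof -
    have "[:1, -1:] ^ n = ([:1, -1:] ^ m * [:1, -1:] ^ (n - m) :: int poly)"
      by (simp only: power_add[symmetric] le_add_diff_inverse[OF assms])
    then show ?thesis by (simp only: power_mult_distrib ac_simps)
  qed
  moreover have "(1 + monom (-1) 2 :: int poly) ^ m = (\<Sum>h\<le>m. monom ((-1) ^ h * int (m choose h)) (2 * h))"
    by (subst add.commute) (simp add: binomial_ring monom_power of_nat_monom mult_monom mult.commute)
  ultimately have "krawtchouk m n
      = (\<Sum>h\<le>m. coeff (monom ((-1) ^ h * int (m choose h)) (2 * h) * [:1, -1:] ^ (n - m)) m)"
    by (simp add: krawtchouk_def sum_distrib_right coeff_sum)
  also have "\<dots> = (\<Sum>h\<le>m. if 2 * h \<le> m then (-1) ^ m * ((-1) ^ h * int (m choose h) * int ((n - m) choose (m - 2 * h))) else 0)"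
  proof (rule sum.cong)
    fix h
    have "(-1 :: int) ^ (m - 2 * h) = (-1) ^ m" if "2 * h \<le> m"
      using that by (simp add: minus_one_power_iff)
    then show "coeff (monom ((-1) ^ h * int (m choose h)) (2 * h) * [:1, -1:] ^ (n - m)) m =
        (if 2 * h \<le> m then (-1) ^ m * ((-1) ^ h * int (m choose h) * int ((n - m) choose (m - 2 * h))) else 0)"
      by (simp add: coeff_monom_mult coeff_one_minus_power)
  qed simp
  also have "\<dots> = (\<Sum>h | h \<le> m \<and> 2 * h \<le> m. (-1) ^ m * ((-1) ^ h * int (m choose h) * int ((n - m) choose (m - 2 * h))))"
    by (simp add: sum.inter_filter[symmetric])
  also have "{h. h \<le> m \<and> 2 * h \<le> m} = {0..m div 2}" by auto
  finally show ?thesis by (simp add: sum_distrib_left)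
qed

theorem theorem1p5:
  fixes a b :: nat
  assumes "2 \<le> a" and "a \<le> b"
  shows "reduced_euler_characteristic pd_le (pd_order_complex a b) =
    (-1) ^ a * (2 * (\<Sum>h = 0..a div 2 - 1.
      (-1) ^ h * int ((a - 2) choose h) * int ((b - a) choose (a - 2 - 2 * h))))"
proof -
  interpret order pd_le "\<lambda>p q. pd_le p q \<and> \<not> pd_le q p" by (rule pd_le_partial_order)
  obtain m n where mn: "a = m + 2" "b = n + 2" "m \<le> n"
    using assms that[of "a - 2" "b - 2"] by simp
  have "reduced_euler_characteristic pd_le (pd_order_complex a b)
      = - (\<Sum>\<sigma>\<in>pd_order_complex a b. (-1) ^ card \<sigma>)"
  proof (rule reduced_euler_characteristic_alternating_sum)
    show "finite (pd_order_complex a b)"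
      using finite_subset[of "pd_order_complex a b" "Pow {q. properly_divides q (a, b)}"]
        finite_proper_divisors[of a b]
      by (auto simp: pd_order_complex_def order_complex_def pd_interval)
    show "{(1, 1)} \<in> pd_order_complex a b"
      using assms
      by (auto simp: pd_order_complex_def order_complex_def pd_interval properly_divides_def chain_def)
    fix \<sigma> assume "\<sigma> \<in> pd_order_complex a b"
    then show "finite \<sigma>" "Complete_Partial_Order.chain pd_le \<sigma>"
      by (simp_all add: pd_order_complex_def order_complex_def)
    show "\<tau> \<in> pd_order_complex a b" if "\<tau> \<subseteq> \<sigma>" for \<tau>
      using \<open>\<sigma> \<in> _\<close> that chain_subset[of pd_le \<sigma> \<tau>] finite_subset[of \<tau> \<sigma>]
      by (auto simp: pd_order_complex_def order_complex_def)
    show "x = y" if "pd_le x y" "pd_le y x" for x y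
      using that by (rule order_antisym)
  qed
  also have "\<dots> = pd_mobius a b"
    using assms by (simp add: pd_mobius_def pd_chain_sum_def)
  also have "\<dots> = 2 * krawtchouk m n"
    by (simp only: mn(1,2) pd_mobius_eq_krawtchouk)
  finally show ?thesis
    by (simp add: krawtchouk_eq_sum[OF mn(3)] mn(1,2))
qed

end
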